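(* Let $(P,\preceq)$ be a locally finite lattice, $f:P\to\mathbb{C}$, and $S=\{x_1,\dots,x_n\}\subseteq P$ indexed so that $x_i\preceq x_j\Rightarrow i\le j$. Let $D=\{d_1,\dots,d_m\}$ be any finite subset of $P$ containing all $x_i\vee x_j$, indexed so that $d_i\preceq d_j\Rightarrow i\le j$. Let $S_i=S\setminus\{x_i\}$. If $[S]_f$ is invertible, then its inverse is the $n\times n$ matrix $B=(b_{ij})$ with $$b_{ij}=\frac{(-1)^{i+j}}{\det[S]_f}\sum_{1\le k_1<\cdots<k_{n-1}\le m}\det E(S_j)_{(k_1,\dots,k_{n-1})}\det E(S_i)_{(k_1,\dots,k_{n-1})}\,\Psi_{D,f}(d_{k_1})\cdots\Psi_{D,f}(d_{k_{n-1}}).$$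
   Context: $[S]_f$ is the $n\times n$ matrix with $(i,j)$ entry $f(x_i\vee x_j)$. $\Psi_{D,f}$ is defined on $D$ recursively by $\Psi_{D,f}(d_k)=f(d_k)-\sum_{d_v\in D,\ d_k\prec d_v}\Psi_{D,f}(d_v)$. For a subset $Z=\{z_1,\dots,z_r\}$ of $P$ (listed in its induced order), $E(Z)$ is the $r\times m$ matrix with $(i,j)$ entry $1$ if $z_i\preceq d_j$ and $0$ otherwise; thus $E(S_i)$ is $E(S)$ with row $i$ deleted. For an $r\times m$ matrix $A$ and $1\le k_1<\dots<k_r\le m$, $A_{(k_1,\dots,k_r)}$ is the $r\times r$ submatrix consisting of columns $k_1,\dots,k_r$. *)

theory Defs
  imports Complex_Main "Jordan_Normal_Form.Determinant"
begin

text \<open>Finite subsets with a fixed indexing are represented by lists, indexed from 0.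
  In the signs (-1)^(i+j) the shift from 1-based indices cancels.\<close>

definition join_mat :: "('p::lattice \<Rightarrow> complex) \<Rightarrow> 'p list \<Rightarrow> complex mat" where
  "join_mat f xs = mat (length xs) (length xs) (\<lambda>(i, j). f (sup (xs ! i) (xs ! j)))"

text \<open>The guard \<open>finite D\<close> only serves termination; the recursion is meant for finite sets.\<close>

function Psi :: "'p::order set \<Rightarrow> ('p \<Rightarrow> complex) \<Rightarrow> 'p \<Rightarrow> complex" where
  "Psi D f d = (if finite D then f d - (\<Sum>v | v \<in> D \<and> d < v. Psi D f v) else 0)"
  by pat_completeness auto
termination
proof (relation "measure (\<lambda>(D, f, d). card {v \<in> D. d < v})")
  fix D :: "'p::order set" and f :: "'p \<Rightarrow> complex" and d v
  assume "finite D" and "v \<in> {v. v \<in> D \<and> d < v}"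
  then have "{w \<in> D. v < w} \<subset> {w \<in> D. d < w}"
    by auto
  with \<open>finite D\<close> show "((D, f, v), (D, f, d)) \<in> measure (\<lambda>(D, f, d). card {v \<in> D. d < v})"
    by (simp add: psubset_card_mono)
qed simp

declare Psi.simps [simp del]

lemma Psi_rec:
  assumes "finite D"
  shows "Psi D f d = f d - (\<Sum>v | v \<in> D \<and> d < v. Psi D f v)"
  using assms by (subst Psi.simps) simp

definition E_mat :: "'p::order list \<Rightarrow> 'p list \<Rightarrow> complex mat" where
  "E_mat zs ds = mat (length zs) (length ds) (\<lambda>(i, j). if zs ! i \<le> ds ! j then 1 else 0)"

definition select_cols :: "'a mat \<Rightarrow> nat list \<Rightarrow> 'a mat" where
  "select_cols A ks = mat_of_cols (dim_row A) (map (col A) ks)"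

definition increasing_tuples :: "nat \<Rightarrow> nat \<Rightarrow> nat list set" where
  "increasing_tuples r m = {ks. length ks = r \<and> sorted_wrt (<) ks \<and> set ks \<subseteq> {..<m}}"

end

theory Submission
  imports Defs "HOL-Library.FuncSet"
begin

text \<open>Moebius inversion gives \<open>f (x \<squnion> y) = (\<Sum>d. \<Psi> d)\<close> over the \<open>d \<in> D\<close> lying above both \<open>x\<close>
  and \<open>y\<close>, so every submatrix of the join matrix factors as \<open>E diag(\<Psi>) E'\<^sup>T\<close>. The minors in the
  adjugate formula for the inverse are then expanded by the Cauchy-Binet formula.\<close>

section \<open>A weighted Cauchy-Binet formula\<close>

lemma select_cols_carrier [simp]:
  "A \<in> carrier_mat r m \<Longrightarrow> length ks = s \<Longrightarrow> select_cols A ks \<in> carrier_mat r s"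
  by (auto simp: select_cols_def)

lemma select_cols_index:
  assumes "A \<in> carrier_mat r m" "length ks = s" "set ks \<subseteq> {..<m}" "i < r" "j < s"
  shows "select_cols A ks $$ (i, j) = A $$ (i, ks ! j)"
proof -
  have "ks ! j < m" using assms by (meson lessThan_iff nth_mem subsetD)
  then show ?thesis using assms by (simp add: select_cols_def mat_of_cols_index)
qed

text \<open>An injective choice of \<open>r\<close> columns amounts to a set of columns, listed
  increasingly, together with an order of picking them. This regroups a sum over injective maps by
  the column set. The \<open>restrict\<close> makes the images extensional, as \<open>PiE\<close>
  requires.\<close>

lemma bij_betw_increasing_tuples_permutations:
  fixes r m :: nat
  shows "bij_betw (\<lambda>(ks, \<sigma>). \<lambda>i\<in>{0..<r}. ks ! \<sigma> i)
    (increasing_tuples r m \<times> {\<sigma>. \<sigma> permutes {0..<r}})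
    {\<phi> \<in> {0..<r} \<rightarrow>\<^sub>E {..<m}. inj_on \<phi> {0..<r}}"
    (is "bij_betw ?h (?K \<times> ?P) ?I")
proof (rule bij_betw_imageI)
  have nth_bij: "bij_betw ((!) ks) {0..<r} (set ks)" if "ks \<in> ?K" for ks
    using that strict_sorted_iff[of ks]
    by (intro bij_betw_nth) (auto simp: increasing_tuples_def atLeast0LessThan)
  have comp_bij: "bij_betw (\<lambda>i. ks ! \<sigma> i) {0..<r} (set ks)"
    if "ks \<in> ?K" "\<sigma> \<in> ?P" for ks \<sigma>
    using bij_betw_trans[OF permutes_imp_bij nth_bij[OF that(1)], of \<sigma>] that(2)
    by (simp add: o_def)
  show "inj_on ?h (?K \<times> ?P)"
  proof (rule inj_onI, clarify)
    fix ks \<sigma> ks' \<sigma>'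
    assume K: "ks \<in> ?K" "ks' \<in> ?K" and P: "\<sigma> permutes {0..<r}" "\<sigma>' permutes {0..<r}"
      and eq: "(\<lambda>i\<in>{0..<r}. ks ! \<sigma> i) = (\<lambda>i\<in>{0..<r}. ks' ! \<sigma>' i)"
    have pt: "ks ! \<sigma> i = ks' ! \<sigma>' i" if "i \<in> {0..<r}" for i
      using fun_cong[OF eq, of i] that by simp
    \<comment> \<open>The common map determines the set of columns, and a strictly increasing list
      is determined by its set; hence \<open>ks = ks'\<close>.\<close>
    have "set ks = (\<lambda>i. ks ! \<sigma> i) ` {0..<r}"
      using comp_bij K P by (auto simp: bij_betw_def)
    also have "\<dots> = (\<lambda>i. ks' ! \<sigma>' i) ` {0..<r}" using pt by (intro image_cong) auto
    also have "\<dots> = set ks'" using comp_bij[of ks' \<sigma>'] K P by (auto simp: bij_betw_def)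
    finally have ks: "ks = ks'"
      using K by (intro strict_sorted_equal) (auto simp: increasing_tuples_def)
    have "\<sigma> i = \<sigma>' i" for i
    proof (cases "i \<in> {0..<r}")
      case True
      then have "\<sigma> i \<in> {0..<r}" "\<sigma>' i \<in> {0..<r}"
        using permutes_in_image[OF P(1), of i] permutes_in_image[OF P(2), of i] by auto
      then show ?thesis using pt[OF True] ks nth_bij[OF K(1)]
        by (auto simp: bij_betw_def dest: inj_onD)
    next
      case False
      then show ?thesis using P by (simp add: permutes_not_in)
    qed
    then show "ks = ks' \<and> \<sigma> = \<sigma>'" using ks by auto
  qed
  show "?h ` (?K \<times> ?P) = ?I"
  proof
    show "?h ` (?K \<times> ?P) \<subseteq> ?I"
    proof (rule image_subsetI)
      fix p assume "p \<in> ?K \<times> ?P"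
      then obtain ks \<sigma> where p: "p = (ks, \<sigma>)" and K: "ks \<in> ?K" and P: "\<sigma> permutes {0..<r}"
        by auto
      have b: "bij_betw (\<lambda>i. ks ! \<sigma> i) {0..<r} (set ks)" using comp_bij K P by simp
      have "set ks \<subseteq> {..<m}" using K by (simp add: increasing_tuples_def)
      then have "?h p \<in> {0..<r} \<rightarrow>\<^sub>E {..<m}"
        using b by (auto simp: p bij_betw_def)
      moreover have "inj_on (?h p) {0..<r}"
        using b by (auto simp: p bij_betw_def inj_on_def)
      ultimately show "?h p \<in> ?I" by blast
    qed
    show "?I \<subseteq> ?h ` (?K \<times> ?P)"
    proof clarify
      fix \<phi> assume \<phi>: "\<phi> \<in> {0..<r} \<rightarrow>\<^sub>E {..<m}" and inj: "inj_on \<phi> {0..<r}"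
      define ks where "ks = sorted_list_of_set (\<phi> ` {0..<r})"
      \<comment> \<open>\<sigma> sends \<open>i\<close> to the position of \<open>\<phi> i\<close>
        in the sorted image; \<open>permutes\<close> demands the identity outside the range.\<close>
      define \<sigma> where "\<sigma> i = (if i \<in> {0..<r} then inv_into {0..<r} ((!) ks) (\<phi> i) else i)" for i
      have K: "ks \<in> ?K" using \<phi> inj
        by (auto simp: increasing_tuples_def ks_def card_image PiE_iff)
      have set: "set ks = \<phi> ` {0..<r}" by (simp add: ks_def)
      have "bij_betw \<phi> {0..<r} (set ks)" using inj set by (simp add: bij_betw_def)
      then have "bij_betw (inv_into {0..<r} ((!) ks) \<circ> \<phi>) {0..<r} {0..<r}"
        using bij_betw_inv_into[OF nth_bij[OF K]] by (rule bij_betw_trans)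
      then have "bij_betw \<sigma> {0..<r} {0..<r}"
        by (rule iffD1[OF bij_betw_cong, rotated]) (simp add: \<sigma>_def)
      then have P: "\<sigma> permutes {0..<r}" by (rule bij_imp_permutes) (simp add: \<sigma>_def)
      have "ks ! \<sigma> i = \<phi> i" if "i \<in> {0..<r}" for i
        using that bij_betw_inv_into_right[OF nth_bij[OF K], of "\<phi> i"] set
        by (simp add: \<sigma>_def)
      then have "\<phi> = ?h (ks, \<sigma>)"
        using PiE_arb[OF \<phi>] by (intro ext) (simp add: restrict_def)
      then show "\<phi> \<in> ?h ` (?K \<times> ?P)" by (rule image_eqI) (simp add: K P)
    qed
  qed
qed

text \<open>The matrix on the left is \<open>A\<close> times the diagonal matrix of \<open>w\<close>
  times the transpose of \<open>B\<close>. Expanding its determinant, one index \<phi>(i) is chosen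
  for each row i; choices with a repetition contribute nothing, and the injective ones are grouped
  by their image.\<close>

theorem weighted_Cauchy_Binet:
  fixes A B :: "'a::comm_ring_1 mat"
  assumes A: "A \<in> carrier_mat r m" and B: "B \<in> carrier_mat r m"
  shows "det (mat r r (\<lambda>(i, j). \<Sum>k<m. A $$ (i, k) * B $$ (j, k) * w k)) =
    (\<Sum>ks\<in>increasing_tuples r m.
      det (select_cols A ks) * det (select_cols B ks) * (\<Prod>k\<leftarrow>ks. w k))"
proof -
  let ?P = "{p. p permutes {0..<r}}" and ?F = "{0..<r} \<rightarrow>\<^sub>E {..<m}"
  let ?K = "increasing_tuples r m"
  \<comment> \<open>Row \<open>i\<close> of \<open>R \<phi>\<close> is column
    \<open>\<phi> i\<close> of \<open>B\<close>. With this transposed layout a repeated value of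
    \<phi> yields equal rows, and permuting the arguments of \<phi> permutes rows.\<close>
  define R where "R \<phi> = mat r r (\<lambda>(i, j). B $$ (j, \<phi> i))" for \<phi>
  have R: "R \<phi> \<in> carrier_mat r r" for \<phi> by (simp add: R_def)
  \<comment> \<open>The total contribution of the choice \<phi>, already summed over the
    permutations in the Leibniz formula.\<close>
  define t where "t \<phi> = (\<Prod>i=0..<r. A $$ (i, \<phi> i) * w (\<phi> i)) * det (R \<phi>)" for \<phi>
  have fin: "finite ?F" by (intro finite_PiE) auto
  have detR: "det (R \<phi>) = (\<Sum>p\<in>?P. signof p * (\<Prod>i=0..<r. B $$ (p i, \<phi> i)))" for \<phi>
    unfolding det_def'[OF R]
    by (intro sum.cong refl arg_cong2[of _ _ _ _ "(*)"] prod.cong)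
      (auto simp: R_def dest: permutes_in_image)
  have zero: "t \<phi> = 0" if "\<not> inj_on \<phi> {0..<r}" for \<phi>
  proof -
    obtain i j where ij: "i < r" "j < r" "i \<noteq> j" "\<phi> i = \<phi> j"
      using \<open>\<not> inj_on \<phi> {0..<r}\<close> by (auto simp: inj_on_def)
    then have "row (R \<phi>) i = row (R \<phi>) j" by (intro eq_vecI) (auto simp: R_def)
    then have "det (R \<phi>) = 0" using det_identical_rows[OF R] ij by blast
    then show ?thesis by (simp add: t_def)
  qed
  have "det (mat r r (\<lambda>(i, j). \<Sum>k<m. A $$ (i, k) * B $$ (j, k) * w k)) =
      (\<Sum>p\<in>?P. signof p * (\<Prod>i=0..<r. \<Sum>k<m. A $$ (i, k) * B $$ (p i, k) * w k))"
    unfolding det_def'[OF mat_carrier]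
    by (intro sum.cong refl arg_cong2[of _ _ _ _ "(*)"] prod.cong)
      (auto dest: permutes_in_image)
  \<comment> \<open>Distributing the product over the inner sums produces the choice functions
    \<phi>; the factors from \<open>A\<close> and \<open>w\<close> do not depend on
    \<open>p\<close>, so the sum over \<open>p\<close> will collapse to
    \<open>det (R \<phi>)\<close>.\<close>
  also have "\<dots> = (\<Sum>p\<in>?P. \<Sum>\<phi>\<in>?F.
      (\<Prod>i=0..<r. A $$ (i, \<phi> i) * w (\<phi> i)) * (signof p * (\<Prod>i=0..<r. B $$ (p i, \<phi> i))))"
    by (subst prod_sum_PiE) (auto simp: sum_distrib_left prod.distrib ac_simps)
  also have "\<dots> = (\<Sum>\<phi>\<in>?F. t \<phi>)"
    by (subst sum.swap) (simp add: t_def detR sum_distrib_left)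
  also have "\<dots> = (\<Sum>\<phi>\<in>{\<phi> \<in> ?F. inj_on \<phi> {0..<r}}. t \<phi>)"
    by (rule sum.mono_neutral_right) (use fin zero in auto)
  also have "\<dots> = (\<Sum>(ks, \<sigma>)\<in>?K \<times> ?P. t (\<lambda>i\<in>{0..<r}. ks ! \<sigma> i))"
    by (subst sum.reindex_bij_betw[OF bij_betw_increasing_tuples_permutations, symmetric])
      (simp add: case_prod_unfold)
  also have "\<dots> = (\<Sum>ks\<in>?K. \<Sum>\<sigma>\<in>?P. t (\<lambda>i\<in>{0..<r}. ks ! \<sigma> i))"
    by (simp add: sum.cartesian_product)
  also have "\<dots> = (\<Sum>ks\<in>?K.
      det (select_cols A ks) * det (select_cols B ks) * (\<Prod>k\<leftarrow>ks. w k))"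
  proof (rule sum.cong[OF refl])
    fix ks assume "ks \<in> ?K"
    then have len: "length ks = r" and sub: "set ks \<subseteq> {..<m}"
      by (auto simp: increasing_tuples_def)
    have cA: "select_cols A ks \<in> carrier_mat r r" and cB: "select_cols B ks \<in> carrier_mat r r"
      using A B len by auto
    have "R ((!) ks) = transpose_mat (select_cols B ks)"
      using cB select_cols_index[OF B len sub] by (intro eq_matI) (auto simp: R_def)
    then have detB: "det (R ((!) ks)) = det (select_cols B ks)"
      using det_transpose[OF cB] by simp
    have W: "(\<Prod>i=0..<r. w (ks ! i)) = (\<Prod>k\<leftarrow>ks. w k)"
      using len by (simp add: prod.list_conv_set_nth)
    have "t (\<lambda>i\<in>{0..<r}. ks ! \<sigma> i) =
        signof \<sigma> * (\<Prod>i=0..<r. select_cols A ks $$ (i, \<sigma> i)) *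
        (det (select_cols B ks) * (\<Prod>k\<leftarrow>ks. w k))" if "\<sigma> \<in> ?P" for \<sigma>
    proof -
      have \<sigma>: "\<sigma> permutes {0..<r}" using that by simp
      have lt: "\<sigma> i < r" if "i < r" for i using permutes_in_image[OF \<sigma>, of i] that by simp
      \<comment> \<open>Reordering the chosen columns by \<sigma> only permutes the rows of
        \<open>R ((!) ks)\<close>, which costs the sign of \<sigma>.\<close>
      have "R (\<lambda>i\<in>{0..<r}. ks ! \<sigma> i) = mat r r (\<lambda>(i, j). R ((!) ks) $$ (\<sigma> i, j))"
        using lt by (intro eq_matI) (auto simp: R_def)
      then have d: "det (R (\<lambda>i\<in>{0..<r}. ks ! \<sigma> i)) = signof \<sigma> * det (select_cols B ks)"
        using det_permute_rows[OF R \<sigma>] detB by simp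
      have "(\<Prod>i=0..<r. w (ks ! \<sigma> i)) = (\<Prod>i=0..<r. w (ks ! i))"
        by (rule prod.reindex_bij_betw[OF permutes_imp_bij[OF \<sigma>], of "\<lambda>i. w (ks ! i)"])
      moreover have "(\<Prod>i=0..<r. A $$ (i, ks ! \<sigma> i)) =
          (\<Prod>i=0..<r. select_cols A ks $$ (i, \<sigma> i))"
        using lt select_cols_index[OF A len sub] by (intro prod.cong) auto
      ultimately show ?thesis using W by (simp add: t_def d prod.distrib ac_simps)
    qed
    \<comment> \<open>The sign and the entries of \<open>A\<close> form the Leibniz expansion of the
      minor of \<open>A\<close>; the minor of \<open>B\<close> and the weights are constant in
      \<sigma>.\<close>
    then have "(\<Sum>\<sigma>\<in>?P. t (\<lambda>i\<in>{0..<r}. ks ! \<sigma> i)) =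
        (\<Sum>\<sigma>\<in>?P. signof \<sigma> * (\<Prod>i=0..<r. select_cols A ks $$ (i, \<sigma> i))) *
        (det (select_cols B ks) * (\<Prod>k\<leftarrow>ks. w k))"
      by (simp add: sum_distrib_right)
    then show "(\<Sum>\<sigma>\<in>?P. t (\<lambda>i\<in>{0..<r}. ks ! \<sigma> i)) =
        det (select_cols A ks) * det (select_cols B ks) * (\<Prod>k\<leftarrow>ks. w k)"
      by (simp add: det_def'[OF cA] mult.assoc)
  qed
  finally show ?thesis .
qed

section \<open>Minors and inverse of the join matrix\<close>

text \<open>This is the recursion for \<open>Psi\<close> with the sum moved to the other side; since
  \<open>d\<close> lies in \<open>D\<close>, it supplies the missing term
  \<open>v = d\<close>.\<close>

lemma sum_Psi_above:
  assumes "finite D" "d \<in> D"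
  shows "(\<Sum>v | v \<in> D \<and> d \<le> v. Psi D f v) = f d"
proof -
  have "{v. v \<in> D \<and> d \<le> v} = insert d {v. v \<in> D \<and> d < v}"
    using assms by (auto simp: less_le)
  then show ?thesis using assms Psi_rec[OF assms(1), of f d] by simp
qed

text \<open>An element lies above both \<open>ys ! i\<close> and \<open>zs ! j\<close> iff it lies
  above their join, so the product of the two incidence entries is the indicator of the up-set of
  the join. Two lists are allowed because a minor deletes different rows and columns.\<close>

lemma sum_E_mat_Psi:
  fixes ys zs ds :: "'p::lattice list"
  assumes "distinct ds" "i < length ys" "j < length zs" "sup (ys ! i) (zs ! j) \<in> set ds"
  shows "(\<Sum>k<length ds. E_mat ys ds $$ (i, k) * E_mat zs ds $$ (j, k) * Psi (set ds) f (ds ! k)) =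
    f (sup (ys ! i) (zs ! j))"
proof -
  let ?s = "sup (ys ! i) (zs ! j)"
  let ?g = "\<lambda>v. if ?s \<le> v then Psi (set ds) f v else 0"
  have "(\<Sum>k<length ds. E_mat ys ds $$ (i, k) * E_mat zs ds $$ (j, k) * Psi (set ds) f (ds ! k)) =
      (\<Sum>k<length ds. ?g (ds ! k))"
    using assms by (intro sum.cong) (auto simp: E_mat_def)
  also have "\<dots> = (\<Sum>v\<in>set ds. ?g v)"
    using sum.reindex_bij_betw[OF bij_betw_nth[OF assms(1) refl refl], of ?g] by simp
  also have "\<dots> = (\<Sum>v | v \<in> set ds \<and> ?s \<le> v. Psi (set ds) f v)"
    by (simp add: sum.If_cases Int_def)
  also have "\<dots> = f ?s" using assms by (intro sum_Psi_above) auto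
  finally show ?thesis .
qed

section \<open>Deleting an entry from a list without repetitions\<close>

lemma removeAll_nth_distinct:
  assumes "distinct xs" "i < length xs"
  shows "removeAll (xs ! i) xs = take i xs @ drop (Suc i) xs"
proof -
  have xs: "xs = take i xs @ xs ! i # drop (Suc i) xs" using assms by (simp add: id_take_nth_drop)
  then have "distinct (take i xs @ xs ! i # drop (Suc i) xs)" using assms by simp
  then have "xs ! i \<notin> set (take i xs)" "xs ! i \<notin> set (drop (Suc i) xs)" by auto
  then show ?thesis by (subst (2) xs) (simp del: append_take_drop_id)
qed

lemma length_removeAll_distinct:
  assumes "distinct xs" "i < length xs"
  shows "length (removeAll (xs ! i) xs) = length xs - 1"
  using assms by (simp add: removeAll_nth_distinct)

text \<open>Indices from \<open>i\<close> on shift by one, the same renumbering that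
  \<open>mat_delete\<close> applies to rows and columns.\<close>

lemma nth_removeAll_distinct:
  assumes "distinct xs" "i < length xs" "a < length xs - 1"
  shows "removeAll (xs ! i) xs ! a = xs ! insert_index i a"
  using assms by (simp add: removeAll_nth_distinct nth_append insert_index_def min_def)

text \<open>Deleting row \<open>i\<close> and column \<open>j\<close> leaves the joins of the
  entries of two shortened lists, so the minor still factors through incidence matrices and the
  weights \<open>Psi\<close>, and the Cauchy-Binet formula applies.\<close>

lemma det_mat_delete_join_mat:
  fixes xs ds :: "'p::lattice list"
  assumes "distinct xs" "distinct ds" "i < length xs" "j < length xs"
    and D: "\<And>i j. i < length xs \<Longrightarrow> j < length xs \<Longrightarrow> sup (xs ! i) (xs ! j) \<in> set ds"
  shows "det (mat_delete (join_mat f xs) i j) =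
    (\<Sum>ks\<in>increasing_tuples (length xs - 1) (length ds).
      det (select_cols (E_mat (removeAll (xs ! i) xs) ds) ks) *
      det (select_cols (E_mat (removeAll (xs ! j) xs) ds) ks) *
      (\<Prod>k\<leftarrow>ks. Psi (set ds) f (ds ! k)))"
proof -
  let ?r = "length xs - 1" and ?m = "length ds"
  let ?y = "removeAll (xs ! i) xs" and ?z = "removeAll (xs ! j) xs"
  note len = length_removeAll_distinct[OF assms(1,3)] length_removeAll_distinct[OF assms(1,4)]
  have nth: "?y ! a = xs ! insert_index i a" "?z ! a = xs ! insert_index j a"
    "insert_index i a < length xs" "insert_index j a < length xs" if "a < ?r" for a
    using that assms by (auto simp: nth_removeAll_distinct insert_index_def)
  have "(\<Sum>k<?m. E_mat ?y ds $$ (a, k) * E_mat ?z ds $$ (b, k) * Psi (set ds) f (ds ! k)) =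
      mat_delete (join_mat f xs) i j $$ (a, b)" if ab: "a < ?r" "b < ?r" for a b
  proof -
    have "sup (?y ! a) (?z ! b) \<in> set ds" using nth ab D by simp
    then have "(\<Sum>k<?m. E_mat ?y ds $$ (a, k) * E_mat ?z ds $$ (b, k) * Psi (set ds) f (ds ! k)) =
        f (sup (?y ! a) (?z ! b))"
      using assms(2) ab len by (intro sum_E_mat_Psi) simp_all
    also have "\<dots> = mat_delete (join_mat f xs) i j $$ (a, b)"
      using nth ab by (simp add: mat_delete_def join_mat_def insert_index_def)
    finally show ?thesis .
  qed
  then have "mat_delete (join_mat f xs) i j = mat ?r ?r (\<lambda>(a, b).
      \<Sum>k<?m. E_mat ?y ds $$ (a, k) * E_mat ?z ds $$ (b, k) * Psi (set ds) f (ds ! k))"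
    by (intro eq_matI) (auto simp: mat_delete_def join_mat_def)
  also have "det \<dots> = (\<Sum>ks\<in>increasing_tuples ?r ?m.
      det (select_cols (E_mat ?y ds) ks) * det (select_cols (E_mat ?z ds) ks) *
      (\<Prod>k\<leftarrow>ks. Psi (set ds) f (ds ! k)))"
    using len by (intro weighted_Cauchy_Binet) (auto simp: E_mat_def)
  finally show ?thesis .
qed

section \<open>Inversion by the adjugate over a field\<close>

lemma invertible_mat_det_nonzero:
  fixes A :: "'a::field mat"
  assumes A: "A \<in> carrier_mat n n" and "invertible_mat A"
  shows "det A \<noteq> 0"
proof -
  obtain B where AB: "A * B = 1\<^sub>m n" and BA: "B * A = 1\<^sub>m (dim_row B)"
    using assms by (auto simp: invertible_mat_def inverts_mat_def)
  \<comment> \<open>The dimensions of \<open>B\<close> are not given; comparing column counts in the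
    two products yields them.\<close>
  have "B \<in> carrier_mat n n"
    using A arg_cong[OF AB, of dim_col] arg_cong[OF BA, of dim_col] by auto
  from det_mult[OF A this] have "det A * det B = 1" by (simp add: AB)
  then show ?thesis by auto
qed

lemma inverts_mat_adj_mat:
  fixes A :: "'a::field mat"
  assumes A: "A \<in> carrier_mat n n" and "det A \<noteq> 0"
  shows "inverts_mat A (inverse (det A) \<cdot>\<^sub>m adj_mat A)"
    and "inverts_mat (inverse (det A) \<cdot>\<^sub>m adj_mat A) A"
proof -
  note adj = adj_mat[OF A]
  have one: "inverse (det A) \<cdot>\<^sub>m (det A \<cdot>\<^sub>m 1\<^sub>m n) = 1\<^sub>m n"
    using assms(2) by (intro eq_matI) auto
  show "inverts_mat A (inverse (det A) \<cdot>\<^sub>m adj_mat A)"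
    using A adj one by (simp add: inverts_mat_def mult_smult_distrib[OF A adj(1)])
  show "inverts_mat (inverse (det A) \<cdot>\<^sub>m adj_mat A) A"
    using A adj one by (simp add: inverts_mat_def mult_smult_assoc_mat[OF adj(1) A])
qed

theorem theorem5p2:
  fixes f :: "'p::lattice \<Rightarrow> complex" and xs ds :: "'p list" and n m :: nat
  assumes locally_finite: "\<And>a b :: 'p. finite {a..b}"
    and "length xs = n" and "distinct xs"
    and "\<And>i j. i < n \<Longrightarrow> j < n \<Longrightarrow> xs ! i \<le> xs ! j \<Longrightarrow> i \<le> j"
    and "length ds = m" and "distinct ds"
    and "\<And>i j. i < n \<Longrightarrow> j < n \<Longrightarrow> sup (xs ! i) (xs ! j) \<in> set ds"
    and "\<And>i j. i < m \<Longrightarrow> j < m \<Longrightarrow> ds ! i \<le> ds ! j \<Longrightarrow> i \<le> j"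
    and "invertible_mat (join_mat f xs)"
    and B: "B = mat n n (\<lambda>(i, j).
      (-1) ^ (i + j) / det (join_mat f xs) *
      (\<Sum>ks\<in>increasing_tuples (n - 1) m.
        det (select_cols (E_mat (removeAll (xs ! j) xs) ds) ks) *
        det (select_cols (E_mat (removeAll (xs ! i) xs) ds) ks) *
        (\<Prod>k\<leftarrow>ks. Psi (set ds) f (ds ! k))))"
  shows "inverts_mat (join_mat f xs) B \<and> inverts_mat B (join_mat f xs)"
proof -
  let ?A = "join_mat f xs"
  have A: "?A \<in> carrier_mat n n" using assms(2) by (simp add: join_mat_def)
  have "B = inverse (det ?A) \<cdot>\<^sub>m adj_mat ?A"
  proof (rule eq_matI)
    fix i j
    assume "i < dim_row (inverse (det ?A) \<cdot>\<^sub>m adj_mat ?A)"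
      and "j < dim_col (inverse (det ?A) \<cdot>\<^sub>m adj_mat ?A)"
    then have ij: "i < n" "j < n" using adj_mat(1)[OF A] by auto
    \<comment> \<open>The adjugate transposes: its entry \<open>(i, j)\<close> is the cofactor at
      \<open>(j, i)\<close>, so \<open>xs ! j\<close> is removed from the rows and
      \<open>xs ! i\<close> from the columns.\<close>
    have "cofactor ?A j i = (-1) ^ (i + j) *
        (\<Sum>ks\<in>increasing_tuples (n - 1) m.
          det (select_cols (E_mat (removeAll (xs ! j) xs) ds) ks) *
          det (select_cols (E_mat (removeAll (xs ! i) xs) ds) ks) *
          (\<Prod>k\<leftarrow>ks. Psi (set ds) f (ds ! k)))"
      using det_mat_delete_join_mat[of xs ds j i f] assms(2,3,5,6,7) ij
      by (simp add: cofactor_def add.commute)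
    then show "B $$ (i, j) = (inverse (det ?A) \<cdot>\<^sub>m adj_mat ?A) $$ (i, j)"
      using ij A by (simp add: B adj_mat_def divide_inverse)
  qed (use A in \<open>auto simp: B adj_mat_def\<close>)
  then show ?thesis
    using inverts_mat_adj_mat[OF A invertible_mat_det_nonzero[OF A assms(9)]] by simp
qed

end
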